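(* Let the data $w_I^n$ be in hydrostatic equilibrium, i.e. for all $I\in\mathcal I$ $$\mathbf u_I=\mathbf 0,\qquad \rho_I=\alpha_I,\qquad p_I=\beta_I .$$ Then the second order scheme is well-balanced, i.e. one step of the scheme gives $w_I^{n+1}=w_I^n$ for all $I\in\mathcal I$.
   Context: **Equations.** The compressible Euler equations with gravity in $d$ space dimensions are $$\partial_t\rho+\nabla\cdot(\rho\mathbf u)=0,\quad \partial_t(\rho\mathbf u)+\nabla\cdot(\rho\mathbf u\otimes\mathbf u+\mathrm{Id}\,p)=-\rho\nabla\Phi,\quad \partial_tE+\nabla\cdot((E+p)\mathbf u)=-\rho\langle\mathbf u,\nabla\Phi\rangle,$$ with $E=\rho e+\tfrac12\rho\|\mathbf u\|^2$, a given potential $\Phi:\mathbb R^d\to\mathbb R$ and a general pressure law $p=p(\tau,e)$, $\tau=1/\rho$ (such that $e$ is determined by $\rho$ and $p$). Write $w=(\rho,\rho\mathbf u,E)$ and, in primitive variables, $w^p=(\rho,\mathbf u,p)$. The admissible set is $\Omega=\{w\in\mathbb R^{d+2}:\rho>0,\ e>0\}$; all data and all reconstructed interface states below are assumed to lie in $\Omega$. A hydrostatic equilibrium to be preserved is given by positive functions $\alpha,\beta$ on $\mathbb R^d$ with $\nabla\beta=-\alpha\nabla\Phi$ (it is the stationary solution $\mathbf u=0,\rho=\alpha,p=\beta$). **Mesh.** Uniform Cartesian mesh with step sizes $\Delta x_i>0$, $i=1,\dots,d$, cell centres $\mathbf x_I$, $I=(I_1,\dots,I_d)\in\mathcal I=\mathbb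 Z^d$; $I(i,k)$ denotes $I$ with $I_i$ replaced by $I_i+k$; $I(i,\pm\frac12)$ labels the interface between $C_I$ and $C_{I(i,\pm1)}$. $w_I^n$ is the cell value at time $t^n$; $\alpha_I=\alpha(\mathbf x_I)$, $\beta_I=\beta(\mathbf x_I)$, $p_I=p(1/\rho_I,e_I)$. $\mathbf n_i$ is the $i$-th unit vector. **Source discretization.** For cell values with index $I$ and its neighbour $J=I(i,1)$, $$\overline S_{I(i,1/2)}=\Big(\tfrac{\rho_J}{\alpha_J}\beta_J-\tfrac{\rho_I}{\alpha_I}\beta_I\Big)-\tfrac12\Big(\tfrac{\rho_J}{\alpha_J}-\tfrac{\rho_I}{\alpha_I}\Big)(\beta_J+\beta_I),$$ always evaluated with cell averages (not with reconstructed values). **Reconstruction.** For each cell $I$ and direction $i$ set $$q_{I,I(i,-1)}=p_{I(i,-1)}+\overline S_{I(i,-1/2)},\quad q_{I,I}=p_I,\quad q_{I,I(i,1)}=p_{I(i,1)}-\overline S_{I(i,1/2)},$$ and on this stencil consider $\bar w^p_{J}=(\rho_J,\mathbf u_J,q_{I,J})$, $J\in\{I(i,-1),I,I(i,1)\}$. The slope is $\sigma_{I,i}=\mathrm{limiter}(\bar w^p_{I(i,-1)},\bar w^p_I,\bar w^p_{I(i,1)})\in\mathbb R^{d+2}$, where the limiter acts componentwise and is any limiter that is consistent: a component of the slope is $0$ whenever the three corresponding input components coincide. The interface values are $w^{p,-}_{I,i}=w^p_I+\sigma_{I,i}\frac{\Delta x_i}2$ (at the interface $I(i,\frac12)$)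 and $w^{p,+}_{I,i}=w^p_I-\sigma_{I,i}\frac{\Delta x_i}2$ (at the interface $I(i,-\frac12)$), with components $(\rho,\mathbf u,p)$. **Interface solver in direction $i$.** Relaxation states are $W=(\rho,\rho\mathbf u,E,\rho\pi,\rho Z)$. At interface $I(i,\frac12)$ let $W_L$ and $W_R$ be the relaxation equilibrium states (i.e. $\pi=p$, $Z=\Phi$) of $w^{p,-}_{I,i}$ and $w^{p,+}_{I(i,1),i}$, let $\overline S=\overline S_{I(i,1/2)}$, let $a>0$ be a relaxation parameter, let $u$ denote the $i$-th velocity component, and define $$u^*=\tfrac12(u_L+u_R)-\tfrac1{2a}(\pi_R-\pi_L-\overline S),$$ $$\tfrac1{\rho_L^*}=\tfrac1{\rho_L}+\tfrac1a(u^*-u_L),\quad \tfrac1{\rho_R^*}=\tfrac1{\rho_R}+\tfrac1a(u_R-u^* ),\quad \pi_L^*=\pi_L+a(u_L-u^* ),\quad \pi_R^*=\pi_R+a(u^*-u_R),$$ $$e_{L}^*=e_{L}+\tfrac{(\pi_{L}^* )^2-\pi_{L}^2}{2a^2},\quad e_{R}^*=e_{R}+\tfrac{(\pi_{R}^* )^2-\pi_{R}^2}{2a^2},\quad Z_{L}^*=Z_{L},\quad Z_R^*=Z_R,$$ where the $i$-th velocity component of both $W_L^*$ and $W_R^*$ is $u^*$, the other velocity components are those of $W_L$, respectively $W_R$, and $E^*=\rho^*e^*+\frac12\rho^*\|\mathbf u^*\|^2$. The wave speeds are $\lambda^-=u_L-a/\rho_L$, $\lambda^{\mathbf u}=u^*$,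 $\lambda^+=u_R+a/\rho_R$, and $a$ is taken such that $\lambda^-<\lambda^{\mathbf u}<\lambda^+$. **Numerical fluxes.** Let $F_{1,i}(W)=(\rho u_i,\ \rho u_i\mathbf u+\pi\mathbf n_i,\ u_i(E+\pi))\in\mathbb R^{d+2}$ and $S=(0,\mathbf n_i\overline S,\lambda^{\mathbf u}\overline S)$, and set $$(F^-_{I(i,1/2)},F^+_{I(i,1/2)})=\begin{cases}(F_{1,i}(W_L),\,F_{1,i}(W_L)+S)&\lambda^-\ge0\\(F_{1,i}(W_L^* ),\,F_{1,i}(W_L^* )+S)&\lambda^{\mathbf u}>0>\lambda^-\\(F_{1,i}(W_L^* ),\,F_{1,i}(W_R^* ))&\lambda^{\mathbf u}=0\\(F_{1,i}(W_R^* )-S,\,F_{1,i}(W_R^* ))&\lambda^+>0>\lambda^{\mathbf u}\\(F_{1,i}(W_R)-S,\,F_{1,i}(W_R))&\lambda^+\le0.\end{cases}$$ **Second order scheme.** For cell data $w_{\mathcal I}=(w_I)_{I\in\mathcal I}$ put $H(w_{\mathcal I})_I=\sum_{i=1}^d\frac1{\Delta x_i}\big(F^-_{I(i,1/2)}-F^+_{I(i,-1/2)}\big)$, where the fluxes are computed from $w_{\mathcal I}$ in the following way: at every interface $I(i,\frac12)$ the source term $\overline S_{I(i,1/2)}$ is evaluated with the cell values $w_I,w_{I(i,1)}$; the slopes $\sigma_{I,i},\sigma_{I(i,1),i}$ and the interface values $w^{p,-}_{I,i},w^{p,+}_{I(i,1),i}$ are obtained from the cell data $w_{\mathcal I}$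 by the reconstruction in the variables $(\rho,\mathbf u,q)$; $W_L,W_R$ are the relaxation equilibrium states of these interface values; $u^*,W_L^*,W_R^*,\lambda^-,\lambda^{\mathbf u},\lambda^+$ are given by the formulas of the interface solver in direction $i$; and $(F^-_{I(i,1/2)},F^+_{I(i,1/2)})$ is then given by the five-case formula for the numerical fluxes. With $\Delta t_1,\Delta t_2>0$ and $\gamma=\frac{2\Delta t_1\Delta t_2}{(\Delta t_1+\Delta t_2)^2}$, $$\bar w_I=w_I^n-\Delta t_1H(w^n_{\mathcal I})_I,\qquad \bar{\bar w}_I=\bar w_I-\Delta t_2H(\bar w_{\mathcal I})_I,\qquad w_I^{n+1}=(1-\gamma)w_I^n+\gamma\bar{\bar w}_I,$$ the total time increment being $\Delta t=\frac{2\Delta t_1\Delta t_2}{\Delta t_1+\Delta t_2}$. *)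

theory Defs
  imports "HOL-Analysis.Analysis"
begin

text \<open>
  A vector of \<open>\<real>\<^bsup>d+2\<^esup>\<close> is a triple. It is used both for conservative states
  \<open>(\<rho>, \<rho>u, E)\<close> and for primitive states \<open>(\<rho>, u, p)\<close>; cells are indexed by \<open>int ^ 'd\<close>.
\<close>

type_synonym 'd state = "real \<times> (real ^ 'd) \<times> real"
type_synonym 'd cell_index = "int ^ 'd"
type_synonym 'd grid = "'d cell_index \<Rightarrow> 'd state"

definition density :: "'d::finite state \<Rightarrow> real"
  where "density w = fst w"

definition momentum :: "'d::finite state \<Rightarrow> real ^ 'd"
  where "momentum w = fst (snd w)"

definition total_energy :: "'d::finite state \<Rightarrow> real"
  where "total_energy w = snd (snd w)"

definition velocity :: "'d::finite state \<Rightarrow> real ^ 'd"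
  where "velocity w = (1 / density w) *\<^sub>R momentum w"

definition internal_energy :: "'d::finite state \<Rightarrow> real"
  where "internal_energy w = total_energy w / density w - (norm (velocity w))\<^sup>2 / 2"

definition Omega :: "'d::finite state set"
  where "Omega = {w. density w > 0 \<and> internal_energy w > 0}"

text \<open>A pressure law \<open>p(\<tau>, e)\<close> takes the specific volume \<open>\<tau> = 1/\<rho>\<close> as its first argument.\<close>

type_synonym pressure_law = "real \<Rightarrow> real \<Rightarrow> real"

definition energy_determined :: "pressure_law \<Rightarrow> bool"
  where "energy_determined p \<longleftrightarrow> (\<forall>\<tau>>0. inj_on (p \<tau>) {e. e > 0})"

definition pressure :: "pressure_law \<Rightarrow> 'd::finite state \<Rightarrow> real"
  where "pressure p w = p (1 / density w) (internal_energy w)"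

definition prim :: "pressure_law \<Rightarrow> 'd::finite state \<Rightarrow> 'd state"
  where "prim p w = (density w, velocity w, pressure p w)"

text \<open>The specific internal energy recovered from density and pressure; it is meaningful on
  primitive states in \<open>prim p ` Omega\<close>.\<close>

definition energy_of :: "pressure_law \<Rightarrow> real \<Rightarrow> real \<Rightarrow> real"
  where "energy_of p \<rho> P = (THE e. e > 0 \<and> p (1 / \<rho>) e = P)"

text \<open>
  The limiter carries the direction as an extra argument because the slope is a difference
  quotient and hence depends on the step size of that direction.
\<close>

record 'd scheme =
  eos :: pressure_law
  grav :: "real ^ 'd \<Rightarrow> real"
  alpha :: "real ^ 'd \<Rightarrow> real"
  beta :: "real ^ 'd \<Rightarrow> real"
  origin :: "real ^ 'd"
  dx :: "real ^ 'd"
  limiter :: "'d \<Rightarrow> 'd state \<Rightarrow> 'd state \<Rightarrow> 'd state \<Rightarrow> 'd state"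

definition centre :: "'d::finite scheme \<Rightarrow> 'd cell_index \<Rightarrow> real ^ 'd"
  where "centre P I = origin P + (\<chi> j. real_of_int (I $ j) * dx P $ j)"

text \<open>\<open>shift I i k\<close> is \<open>I(i,k)\<close>. Quantities living on interfaces are indexed by \<open>I\<close> and \<open>i\<close>,
  which stand for \<open>I(i,1/2)\<close>; thus \<open>I(i,-1/2)\<close> is represented by \<open>shift I i (-1)\<close> and \<open>i\<close>.\<close>

definition shift :: "'d::finite cell_index \<Rightarrow> 'd \<Rightarrow> int \<Rightarrow> 'd cell_index"
  where "shift I i k = (\<chi> j. if j = i then I $ j + k else I $ j)"

definition componentwise_limiter ::
    "('d::finite state \<Rightarrow> 'd state \<Rightarrow> 'd state \<Rightarrow> 'd state) \<Rightarrow> bool"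
  where "componentwise_limiter L \<longleftrightarrow>
    (\<exists>l\<rho> lu lp. \<forall>\<rho>1 u1 p1 \<rho>2 u2 p2 \<rho>3 u3 p3.
       L (\<rho>1, u1, p1) (\<rho>2, u2, p2) (\<rho>3, u3, p3) =
         (l\<rho> \<rho>1 \<rho>2 \<rho>3, (\<chi> j. lu j (u1 $ j) (u2 $ j) (u3 $ j)), lp p1 p2 p3))"

definition consistent_limiter ::
    "('d::finite state \<Rightarrow> 'd state \<Rightarrow> 'd state \<Rightarrow> 'd state) \<Rightarrow> bool"
  where "consistent_limiter L \<longleftrightarrow>
    (\<forall>\<rho>1 u1 p1 \<rho>2 u2 p2 \<rho>3 u3 p3 \<sigma>\<rho> \<sigma>u \<sigma>p.
       L (\<rho>1, u1, p1) (\<rho>2, u2, p2) (\<rho>3, u3, p3) = (\<sigma>\<rho>, \<sigma>u, \<sigma>p) \<longrightarrow>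
         (\<rho>1 = \<rho>2 \<and> \<rho>2 = \<rho>3 \<longrightarrow> \<sigma>\<rho> = 0) \<and>
         (\<forall>j. u1 $ j = u2 $ j \<and> u2 $ j = u3 $ j \<longrightarrow> \<sigma>u $ j = 0) \<and>
         (p1 = p2 \<and> p2 = p3 \<longrightarrow> \<sigma>p = 0))"

definition source :: "'d::finite scheme \<Rightarrow> 'd grid \<Rightarrow> 'd cell_index \<Rightarrow> 'd \<Rightarrow> real"
  where "source P w I i =
    (let J = shift I i 1;
         \<rho>I = density (w I); \<rho>J = density (w J);
         \<alpha>I = alpha P (centre P I); \<alpha>J = alpha P (centre P J);
         \<beta>I = beta P (centre P I); \<beta>J = beta P (centre P J)
     in (\<rho>J / \<alpha>J * \<beta>J - \<rho>I / \<alpha>I * \<beta>I) - 1 / 2 * (\<rho>J / \<alpha>J - \<rho>I / \<alpha>I) * (\<beta>J + \<beta>I))"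

definition stencil_prev :: "'d::finite scheme \<Rightarrow> 'd grid \<Rightarrow> 'd cell_index \<Rightarrow> 'd \<Rightarrow> 'd state"
  where "stencil_prev P w I i =
    (let J = shift I i (-1)
     in (density (w J), velocity (w J), pressure (eos P) (w J) + source P w J i))"

definition stencil_mid :: "'d::finite scheme \<Rightarrow> 'd grid \<Rightarrow> 'd cell_index \<Rightarrow> 'd state"
  where "stencil_mid P w I = (density (w I), velocity (w I), pressure (eos P) (w I))"

definition stencil_next :: "'d::finite scheme \<Rightarrow> 'd grid \<Rightarrow> 'd cell_index \<Rightarrow> 'd \<Rightarrow> 'd state"
  where "stencil_next P w I i =
    (let J = shift I i 1
     in (density (w J), velocity (w J), pressure (eos P) (w J) - source P w I i))"

definition slope :: "'d::finite scheme \<Rightarrow> 'd grid \<Rightarrow> 'd cell_index \<Rightarrow> 'd \<Rightarrow> 'd state"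
  where "slope P w I i =
    limiter P i (stencil_prev P w I i) (stencil_mid P w I) (stencil_next P w I i)"

text \<open>\<open>edge_minus\<close> is the value of cell \<open>I\<close> at \<open>I(i,1/2)\<close>, \<open>edge_plus\<close> the one at \<open>I(i,-1/2)\<close>.\<close>

definition edge_minus :: "'d::finite scheme \<Rightarrow> 'd grid \<Rightarrow> 'd cell_index \<Rightarrow> 'd \<Rightarrow> 'd state"
  where "edge_minus P w I i = prim (eos P) (w I) + (dx P $ i / 2) *\<^sub>R slope P w I i"

definition edge_plus :: "'d::finite scheme \<Rightarrow> 'd grid \<Rightarrow> 'd cell_index \<Rightarrow> 'd \<Rightarrow> 'd state"
  where "edge_plus P w I i = prim (eos P) (w I) - (dx P $ i / 2) *\<^sub>R slope P w I i"

record 'd relax =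
  r_rho :: real
  r_mom :: "real ^ 'd"
  r_en :: real
  r_rpi :: real
  r_rZ :: real

definition r_vel :: "'d::finite relax \<Rightarrow> real ^ 'd"
  where "r_vel W = (1 / r_rho W) *\<^sub>R r_mom W"

definition r_pi :: "'d::finite relax \<Rightarrow> real"
  where "r_pi W = r_rpi W / r_rho W"

definition r_Z :: "'d::finite relax \<Rightarrow> real"
  where "r_Z W = r_rZ W / r_rho W"

definition r_e :: "'d::finite relax \<Rightarrow> real"
  where "r_e W = r_en W / r_rho W - (norm (r_vel W))\<^sup>2 / 2"

definition mk_relax :: "real \<Rightarrow> real ^ 'd \<Rightarrow> real \<Rightarrow> real \<Rightarrow> real \<Rightarrow> 'd::finite relax"
  where "mk_relax \<rho> u e \<pi> Z =
    \<lparr>r_rho = \<rho>, r_mom = \<rho> *\<^sub>R u, r_en = \<rho> * e + \<rho> * (norm u)\<^sup>2 / 2, r_rpi = \<rho> * \<pi>, r_rZ = \<rho> * Z\<rparr>"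

definition relax_equilibrium :: "pressure_law \<Rightarrow> real \<Rightarrow> 'd::finite state \<Rightarrow> 'd relax"
  where "relax_equilibrium p Z v =
    (case v of (\<rho>, u, P) \<Rightarrow> mk_relax \<rho> u (energy_of p \<rho> P) P Z)"

text \<open>In the following \<open>i\<close> is the direction, \<open>a\<close> the relaxation parameter, \<open>S\<close> the discrete
  source and \<open>L\<close>, \<open>R\<close> the states on both sides of the interface.\<close>

definition u_star :: "'d::finite \<Rightarrow> real \<Rightarrow> real \<Rightarrow> 'd relax \<Rightarrow> 'd relax \<Rightarrow> real"
  where "u_star i a S L R =
    (r_vel L $ i + r_vel R $ i) / 2 - 1 / (2 * a) * (r_pi R - r_pi L - S)"

definition star_state :: "'d::finite \<Rightarrow> real \<Rightarrow> real \<Rightarrow> real \<Rightarrow> real \<Rightarrow> 'd relax \<Rightarrow> 'd relax"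
  where "star_state i a us \<tau>s \<pi>s W =
    mk_relax (1 / \<tau>s) (\<chi> j. if j = i then us else r_vel W $ j)
      (r_e W + (\<pi>s\<^sup>2 - (r_pi W)\<^sup>2) / (2 * a\<^sup>2)) \<pi>s (r_Z W)"

definition W_star_L :: "'d::finite \<Rightarrow> real \<Rightarrow> real \<Rightarrow> 'd relax \<Rightarrow> 'd relax \<Rightarrow> 'd relax"
  where "W_star_L i a S L R =
    (let us = u_star i a S L R
     in star_state i a us (1 / r_rho L + 1 / a * (us - r_vel L $ i))
          (r_pi L + a * (r_vel L $ i - us)) L)"

definition W_star_R :: "'d::finite \<Rightarrow> real \<Rightarrow> real \<Rightarrow> 'd relax \<Rightarrow> 'd relax \<Rightarrow> 'd relax"
  where "W_star_R i a S L R =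
    (let us = u_star i a S L R
     in star_state i a us (1 / r_rho R + 1 / a * (r_vel R $ i - us))
          (r_pi R + a * (us - r_vel R $ i)) R)"

definition lambda_minus :: "'d::finite \<Rightarrow> real \<Rightarrow> 'd relax \<Rightarrow> real"
  where "lambda_minus i a L = r_vel L $ i - a / r_rho L"

definition lambda_plus :: "'d::finite \<Rightarrow> real \<Rightarrow> 'd relax \<Rightarrow> real"
  where "lambda_plus i a R = r_vel R $ i + a / r_rho R"

definition phys_flux :: "'d::finite \<Rightarrow> 'd relax \<Rightarrow> 'd state"
  where "phys_flux i W =
    (let u = r_vel W
     in (r_rho W * u $ i,
         (r_rho W * u $ i) *\<^sub>R u + r_pi W *\<^sub>R axis i 1,
         u $ i * (r_en W + r_pi W)))"

text \<open>The two components of the result are \<open>F\<^sup>-\<close> and \<open>F\<^sup>+\<close>.\<close>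

definition num_flux ::
    "'d::finite \<Rightarrow> real \<Rightarrow> real \<Rightarrow> 'd relax \<Rightarrow> 'd relax \<Rightarrow> 'd state \<times> 'd state"
  where "num_flux i a S L R =
    (let lm = lambda_minus i a L;
         lu = u_star i a S L R;
         lp = lambda_plus i a R;
         FL = phys_flux i L;
         FR = phys_flux i R;
         FLs = phys_flux i (W_star_L i a S L R);
         FRs = phys_flux i (W_star_R i a S L R);
         Sv = (0, S *\<^sub>R axis i 1, lu * S)
     in if lm \<ge> 0 then (FL, FL + Sv)
        else if lu > 0 \<and> 0 > lm then (FLs, FLs + Sv)
        else if lu = 0 then (FLs, FRs)
        else if lp > 0 \<and> 0 > lu then (FRs - Sv, FRs)
        else (FR - Sv, FR))"

text \<open>The potential in the relaxation equilibrium states is sampled at the cell centre. The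
  fluxes do not depend on it.\<close>

definition W_left :: "'d::finite scheme \<Rightarrow> 'd grid \<Rightarrow> 'd cell_index \<Rightarrow> 'd \<Rightarrow> 'd relax"
  where "W_left P w I i =
    relax_equilibrium (eos P) (grav P (centre P I)) (edge_minus P w I i)"

definition W_right :: "'d::finite scheme \<Rightarrow> 'd grid \<Rightarrow> 'd cell_index \<Rightarrow> 'd \<Rightarrow> 'd relax"
  where "W_right P w I i =
    (let J = shift I i 1
     in relax_equilibrium (eos P) (grav P (centre P J)) (edge_plus P w J i))"

text \<open>The relaxation parameter may vary from interface to interface.\<close>

definition interface_flux ::
    "'d::finite scheme \<Rightarrow> ('d cell_index \<Rightarrow> 'd \<Rightarrow> real) \<Rightarrow> 'd grid \<Rightarrow> 'd cell_index \<Rightarrow> 'd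
      \<Rightarrow> 'd state \<times> 'd state"
  where "interface_flux P a w I i =
    num_flux i (a I i) (source P w I i) (W_left P w I i) (W_right P w I i)"

definition H :: "'d::finite scheme \<Rightarrow> ('d cell_index \<Rightarrow> 'd \<Rightarrow> real) \<Rightarrow> 'd grid \<Rightarrow> 'd grid"
  where "H P a w I =
    (\<Sum>i\<in>UNIV. (1 / dx P $ i) *\<^sub>R
       (fst (interface_flux P a w I i) - snd (interface_flux P a w (shift I i (-1)) i)))"

definition euler_step ::
    "'d::finite scheme \<Rightarrow> ('d cell_index \<Rightarrow> 'd \<Rightarrow> real) \<Rightarrow> real \<Rightarrow> 'd grid \<Rightarrow> 'd grid"
  where "euler_step P a \<Delta>t w I = w I - \<Delta>t *\<^sub>R H P a w I"

definition second_order_step ::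
    "'d::finite scheme \<Rightarrow> ('d cell_index \<Rightarrow> 'd \<Rightarrow> real) \<Rightarrow> ('d cell_index \<Rightarrow> 'd \<Rightarrow> real)
      \<Rightarrow> real \<Rightarrow> real \<Rightarrow> 'd grid \<Rightarrow> 'd grid"
  where "second_order_step P a1 a2 \<Delta>t1 \<Delta>t2 w I =
    (let \<gamma> = 2 * \<Delta>t1 * \<Delta>t2 / (\<Delta>t1 + \<Delta>t2)\<^sup>2;
         w1 = euler_step P a1 \<Delta>t1 w;
         w2 = euler_step P a2 \<Delta>t2 w1
     in (1 - \<gamma>) *\<^sub>R w I + \<gamma> *\<^sub>R w2 I)"

text \<open>Standing assumptions on the data entering one evaluation of \<open>H\<close>: cell values and
  reconstructed interface values are admissible, and the relaxation parameters are positive and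
  order the wave speeds.\<close>

definition data_admissible :: "'d::finite scheme \<Rightarrow> 'd grid \<Rightarrow> bool"
  where "data_admissible P w \<longleftrightarrow>
    (\<forall>I. w I \<in> Omega) \<and>
    (\<forall>I i. edge_minus P w I i \<in> prim (eos P) ` Omega \<and> edge_plus P w I i \<in> prim (eos P) ` Omega)"

definition relaxation_admissible ::
    "'d::finite scheme \<Rightarrow> ('d cell_index \<Rightarrow> 'd \<Rightarrow> real) \<Rightarrow> 'd grid \<Rightarrow> bool"
  where "relaxation_admissible P a w \<longleftrightarrow>
    (\<forall>I i. let L = W_left P w I i; R = W_right P w I i; us = u_star i (a I i) (source P w I i) L R
           in a I i > 0 \<and> lambda_minus i (a I i) L < us \<and> us < lambda_plus i (a I i) R)"

definition scheme_admissible :: "'d::finite scheme \<Rightarrow> bool"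
  where "scheme_admissible P \<longleftrightarrow>
    energy_determined (eos P) \<and>
    (\<forall>x. alpha P x > 0 \<and> beta P x > 0) \<and>
    (\<forall>x. \<exists>g. GDERIV (grav P) x :> g \<and> GDERIV (beta P) x :> - (alpha P x *\<^sub>R g)) \<and>
    (\<forall>i. dx P $ i > 0) \<and>
    (\<forall>i. componentwise_limiter (limiter P i) \<and> consistent_limiter (limiter P i))"

definition hydrostatic :: "'d::finite scheme \<Rightarrow> 'd grid \<Rightarrow> bool"
  where "hydrostatic P w \<longleftrightarrow>
    (\<forall>I. velocity (w I) = 0 \<and> density (w I) = alpha P (centre P I) \<and>
         pressure (eos P) (w I) = beta P (centre P I))"

end

theory Submission
  imports Defs
begin

text \<open>
  On hydrostatic data the reconstruction may change the densities, but it sees neither velocities nor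
  pressure differences. Indeed \<open>\<rho>/\<alpha> = 1\<close> in every cell, so the discrete source at an interface is
  exactly the jump of \<open>\<beta>\<close> (\<open>source_hydrostatic\<close>). The variable \<open>q\<close>, which is the pressure corrected
  by this source, is therefore constant on each stencil, and a consistent limiter produces no slope
  in velocity and pressure (\<open>slope_hydrostatic\<close>). The interface values of a cell \<open>I\<close> are
  thus at rest with pressure \<open>\<beta>\<^sub>I\<close>, and only their densities, positive by admissibility, are unknown.

  For states at rest whose pressure jump equals the source, the interface solver has a stationary
  contact, \<open>u\<^sup>* = 0\<close>. The intermediate states keep the pressures of their sides, so both one-sided
  fluxes reduce to the pressure term (\<open>num_flux_rest\<close>) and no longer contain the densities. The two
  fluxes that cell \<open>I\<close> receives in direction \<open>i\<close> are then both \<open>(0, \<beta>\<^sub>I n\<^sub>i, 0)\<close>, so \<open>H\<close> vanishes.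
  Hence each forward Euler stage reproduces its input, and so does the convex combination.
\<close>

lemma shift_shift_back [simp]:
  "shift (shift I i (-1)) i 1 = I" for I :: "'d::finite cell_index"
  by (simp add: shift_def vec_eq_iff)

lemma mk_relax_components:
  assumes "\<rho> \<noteq> 0"
  shows "r_vel (mk_relax \<rho> u e \<pi> Z) = u" "r_pi (mk_relax \<rho> u e \<pi> Z) = \<pi>"
    and "r_rho (mk_relax \<rho> u e \<pi> Z) = \<rho>"
  using assms by (simp_all add: mk_relax_def r_vel_def r_pi_def)

text \<open>
  Every convective contribution to the flux carries a factor of the normal velocity, which leaves
  only the pressure. Velocity and pressure are recovered by dividing by the density \<open>1/\<tau>\<close>, which must
  therefore not be the default value \<open>1/0 = 0\<close>.
\<close>

lemma phys_flux_star_state_rest: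
  fixes W :: "'d::finite relax"
  assumes "r_vel W = 0" "\<tau> \<noteq> 0"
  shows "phys_flux i (star_state i a 0 \<tau> \<pi> W) = (0, \<pi> *\<^sub>R axis i 1, 0)"
proof -
  have "(\<chi> j. if j = i then 0 else r_vel W $ j) = 0"
    using assms(1) by (simp add: vec_eq_iff)
  then show ?thesis
    using assms(2) by (simp add: star_state_def phys_flux_def mk_relax_components)
qed

text \<open>
  The source cancels the pressure jump in \<open>u\<^sup>*\<close>, so that the contact is stationary and the third case
  of the flux formula applies. The densities may be any positive numbers, which is why a slope
  in the density does no harm.
\<close>

lemma num_flux_rest:
  fixes L R :: "'d::finite relax"
  assumes a: "a > 0"
    and rho: "r_rho L > 0" "r_rho R > 0"
    and rest: "r_vel L = 0" "r_vel R = 0"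
    and balance: "r_pi R - r_pi L = S"
  shows "num_flux i a S L R = ((0, r_pi L *\<^sub>R axis i 1, 0), (0, r_pi R *\<^sub>R axis i 1, 0))"
proof -
  have us: "u_star i a S L R = 0"
    using rest balance by (simp add: u_star_def)
  have lm: "\<not> lambda_minus i a L \<ge> 0"
    using a rho rest by (simp add: lambda_minus_def not_le)
  have "phys_flux i (W_star_L i a S L R) = (0, r_pi L *\<^sub>R axis i 1, 0)"
    using rho rest by (simp add: W_star_L_def us phys_flux_star_state_rest)
  moreover have "phys_flux i (W_star_R i a S L R) = (0, r_pi R *\<^sub>R axis i 1, 0)"
    using rho rest by (simp add: W_star_R_def us phys_flux_star_state_rest)
  ultimately show ?thesis
    by (simp add: num_flux_def us lm)
qed

lemma source_hydrostatic:
  assumes "hydrostatic P w" and "\<And>x. alpha P x > 0"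
  shows "source P w I i = beta P (centre P (shift I i 1)) - beta P (centre P I)"
  using assms(1) less_imp_neq[OF assms(2), symmetric]
  by (simp add: hydrostatic_def source_def Let_def)

text \<open>
  The source correction replaces both neighbouring pressures by \<open>\<beta>\<^sub>I\<close>, so the limiter sees constant
  velocity and pressure. It does see the variation of \<open>\<alpha>\<close>, so a density slope has to be allowed.
\<close>

lemma slope_hydrostatic:
  assumes scheme: "scheme_admissible P" and hyd: "hydrostatic P w"
  obtains \<sigma>\<rho> where "slope P w I i = (\<sigma>\<rho>, 0, 0)"
proof -
  have src: "source P w J i = beta P (centre P (shift J i 1)) - beta P (centre P J)" for J
    using source_hydrostatic[OF hyd] scheme by (simp add: scheme_admissible_def)
  have cell: "velocity (w J) = 0" "pressure (eos P) (w J) = beta P (centre P J)" for J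
    using hyd by (simp_all add: hydrostatic_def)
  obtain \<sigma>\<rho> \<sigma>u \<sigma>p where s: "slope P w I i = (\<sigma>\<rho>, \<sigma>u, \<sigma>p)"
    by (metis prod.exhaust)
  let ?\<beta> = "beta P (centre P I)"
  have "limiter P i (density (w (shift I i (-1))), 0, ?\<beta>) (density (w I), 0, ?\<beta>)
      (density (w (shift I i 1)), 0, ?\<beta>) = (\<sigma>\<rho>, \<sigma>u, \<sigma>p)"
    using s by (simp add: slope_def stencil_prev_def stencil_mid_def stencil_next_def src cell)
  moreover have "consistent_limiter (limiter P i)"
    using scheme by (simp add: scheme_admissible_def)
  ultimately have "(\<forall>j. \<sigma>u $ j = 0) \<and> \<sigma>p = 0"
    unfolding consistent_limiter_def by blast
  then have "\<sigma>u = 0" "\<sigma>p = 0"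
    by (simp_all add: vec_eq_iff)
  with s that show thesis by simp
qed

text \<open>
  An admissible primitive state is the image of a state in \<open>Omega\<close>, so its density is positive even
  after an uncontrolled density slope has been added.
\<close>

lemma edge_hydrostatic:
  assumes scheme: "scheme_admissible P" and hyd: "hydrostatic P w" and data: "data_admissible P w"
  shows "\<exists>\<rho>>0. edge_minus P w I i = (\<rho>, 0, beta P (centre P I))"
    and "\<exists>\<rho>>0. edge_plus P w I i = (\<rho>, 0, beta P (centre P I))"
proof -
  have pos: "fst v > 0" if "v \<in> prim (eos P) ` Omega" for v :: "'a state"
    using that by (auto simp: prim_def Omega_def)
  obtain \<sigma>\<rho> where "slope P w I i = (\<sigma>\<rho>, 0, 0)"
    using slope_hydrostatic[OF scheme hyd] .
  then have
    "edge_minus P w I i = (density (w I) + dx P $ i / 2 * \<sigma>\<rho>, 0, beta P (centre P I))"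
    "edge_plus P w I i = (density (w I) - dx P $ i / 2 * \<sigma>\<rho>, 0, beta P (centre P I))"
    using hyd by (simp_all add: edge_minus_def edge_plus_def prim_def hydrostatic_def)
  moreover have "fst (edge_minus P w I i) > 0" "fst (edge_plus P w I i) > 0"
    using data pos unfolding data_admissible_def by blast+
  ultimately show "\<exists>\<rho>>0. edge_minus P w I i = (\<rho>, 0, beta P (centre P I))"
    and "\<exists>\<rho>>0. edge_plus P w I i = (\<rho>, 0, beta P (centre P I))"
    by auto
qed

lemma interface_flux_hydrostatic:
  assumes scheme: "scheme_admissible P" and hyd: "hydrostatic P w" and data: "data_admissible P w"
    and relax: "relaxation_admissible P a w"
  shows "interface_flux P a w I i =
    ((0, beta P (centre P I) *\<^sub>R axis i 1, 0),
     (0, beta P (centre P (shift I i 1)) *\<^sub>R axis i 1, 0))"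
proof -
  let ?L = "W_left P w I i" and ?R = "W_right P w I i"
  obtain \<rho>L where "\<rho>L > 0" "edge_minus P w I i = (\<rho>L, 0, beta P (centre P I))"
    using edge_hydrostatic(1)[OF scheme hyd data] by blast
  then have L: "r_rho ?L > 0" "r_vel ?L = 0" "r_pi ?L = beta P (centre P I)"
    by (simp_all add: W_left_def relax_equilibrium_def mk_relax_components)
  obtain \<rho>R where
    "\<rho>R > 0" "edge_plus P w (shift I i 1) i = (\<rho>R, 0, beta P (centre P (shift I i 1)))"
    using edge_hydrostatic(2)[OF scheme hyd data] by blast
  then have R: "r_rho ?R > 0" "r_vel ?R = 0" "r_pi ?R = beta P (centre P (shift I i 1))"
    by (simp_all add: W_right_def Let_def relax_equilibrium_def mk_relax_components)
  have "a I i > 0"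
    using relax by (simp add: relaxation_admissible_def Let_def)
  have "r_pi ?R - r_pi ?L = source P w I i"
    using source_hydrostatic[OF hyd] scheme L R by (simp add: scheme_admissible_def)
  from num_flux_rest[OF \<open>a I i > 0\<close> L(1) R(1) L(2) R(2) this] show ?thesis
    by (simp add: interface_flux_def L R)
qed

text \<open>
  Across a cell the fluxes cancel although they differ across an interface: both \<open>F\<^sup>-\<close> at \<open>I(i,1/2)\<close>
  and \<open>F\<^sup>+\<close> at \<open>I(i,-1/2)\<close> carry the equilibrium pressure of cell \<open>I\<close> itself.
\<close>

lemma euler_step_hydrostatic:
  assumes "scheme_admissible P" "hydrostatic P w" "data_admissible P w"
    and "relaxation_admissible P a w"
  shows "euler_step P a \<Delta>t w = w"
proof
  fix I
  have "H P a w I = 0"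
    by (simp add: H_def interface_flux_hydrostatic[OF assms])
  then show "euler_step P a \<Delta>t w I = w I"
    by (simp add: euler_step_def)
qed

theorem theorem9:
  fixes P :: "'d::finite scheme"
    and a1 a2 :: "'d cell_index \<Rightarrow> 'd \<Rightarrow> real"
    and \<Delta>t1 \<Delta>t2 :: real
    and w :: "'d grid"
  assumes scheme: "scheme_admissible P"
    and dt: "\<Delta>t1 > 0" "\<Delta>t2 > 0"
    and data1: "data_admissible P w"
    and relax1: "relaxation_admissible P a1 w"
    and data2: "data_admissible P (euler_step P a1 \<Delta>t1 w)"
    and relax2: "relaxation_admissible P a2 (euler_step P a1 \<Delta>t1 w)"
    and equilibrium: "hydrostatic P w"
  shows "\<forall>I. second_order_step P a1 a2 \<Delta>t1 \<Delta>t2 w I = w I"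
proof -
  note first = euler_step_hydrostatic[OF scheme equilibrium data1 relax1]
  have "euler_step P a2 \<Delta>t2 w = w"
    using euler_step_hydrostatic[OF scheme equilibrium data1] relax2 by (simp add: first)
  then show ?thesis
    by (simp add: second_order_step_def Let_def first scaleR_left.diff)
qed

end
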